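(* $\mathcal{C}\subsetneq\mathrm{CREG}$, where $\mathcal{C}$ is the smallest family of languages containing all commutative languages with the semilinear property and closed under union and concatenation.
   Context: For $x\in\Sigma^*$, $\Sigma=\{a_1,\dots,a_k\}$, $\Psi(x)=[|x|_{a_1},\dots,|x|_{a_k}]$ (extended to languages). $L$ is commutative if $L=\{x\mid\Psi(x)\in\Psi(L)\}$. $L$ has the linear property if $\Psi(L)=\{\vec c+\sum_{i=1}^q n_i\vec p^{(i)}\mid n_i\ge0\}$ for some $\vec c,\vec p^{(1)},\dots,\vec p^{(q)}\in\mathbb N^k$; it has the semilinear property if it is a finite union of languages with the linear property. Consensual languages: let $\mathring\Sigma=\{\mathring a\mid a\in\Sigma\}$ be a disjoint dotted copy and $\widetilde\Sigma=\Sigma\cup\mathring\Sigma$. The match on letters is $a@\mathring a=\mathring a@a=a$, $\mathring a@\mathring a=\mathring a$, undefined otherwise; on words of equal length it is applied letterwise and is defined iff every position is defined ($\epsilon@\epsilon=\epsilon$), undefined for unequal lengths; on languages $B_1@B_2=\{w_1@w_2\mid w_1\in B_1,w_2\in B_2,\ w_1@w_2\text{ defined}\}$. $B^{0@}=B$, $B^{i@}=B^{(i-1)@}@B$, $B^@=\bigcup_{i\ge0}B^{i@}$, and $\mathcal{C}(B)=B^@\cap\Sigma^*$. CREG (consensually regular languages) is the family of all $\mathcal{C}(B)$ with $B\subseteq\widetilde\Sigma^*$ regular. *)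

theory Defs
  imports Main
begin

definition parikh :: "nat list \<Rightarrow> (nat \<Rightarrow> nat)" where
  "parikh x = (\<lambda>a. count_list x a)"

definition commutative :: "nat set \<Rightarrow> nat list set \<Rightarrow> bool" where
  "commutative \<Sigma> L \<longleftrightarrow> L = {x \<in> lists \<Sigma>. parikh x \<in> parikh ` L}"

definition linear_prop :: "nat list set \<Rightarrow> bool" where
  "linear_prop L \<longleftrightarrow> (\<exists>(c::nat \<Rightarrow> nat) (ps::(nat \<Rightarrow> nat) list).
     parikh ` L = {(\<lambda>a. c a + (\<Sum>i<length ps. n i * (ps ! i) a)) | n::nat \<Rightarrow> nat. True})"

definition semilinear_prop :: "nat list set \<Rightarrow> bool" where
  "semilinear_prop L \<longleftrightarrow> (\<exists>F. finite F \<and> (\<forall>M\<in>F. linear_prop M) \<and> L = \<Union>F)"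

definition conc :: "'b list set \<Rightarrow> 'b list set \<Rightarrow> 'b list set" where
  "conc A B = {u @ v | u v. u \<in> A \<and> v \<in> B}"

inductive_set Cfam :: "nat set \<Rightarrow> nat list set set" for \<Sigma> :: "nat set" where
  base: "L \<subseteq> lists \<Sigma> \<Longrightarrow> commutative \<Sigma> L \<Longrightarrow> semilinear_prop L \<Longrightarrow> L \<in> Cfam \<Sigma>"
| union: "A \<in> Cfam \<Sigma> \<Longrightarrow> B \<in> Cfam \<Sigma> \<Longrightarrow> A \<union> B \<in> Cfam \<Sigma>"
| concat: "A \<in> Cfam \<Sigma> \<Longrightarrow> B \<in> Cfam \<Sigma> \<Longrightarrow> conc A B \<in> Cfam \<Sigma>"

datatype 'b rexp = Zero | One | Atom 'b | Plus "'b rexp" "'b rexp"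
  | Times "'b rexp" "'b rexp" | Star "'b rexp"

fun lpow :: "'b list set \<Rightarrow> nat \<Rightarrow> 'b list set" where
  "lpow A 0 = {[]}"
| "lpow A (Suc n) = conc A (lpow A n)"

fun rlang :: "'b rexp \<Rightarrow> 'b list set" where
  "rlang Zero = {}"
| "rlang One = {[]}"
| "rlang (Atom a) = {[a]}"
| "rlang (Plus r s) = rlang r \<union> rlang s"
| "rlang (Times r s) = conc (rlang r) (rlang s)"
| "rlang (Star r) = (\<Union>n. lpow (rlang r) n)"

definition regular :: "'b list set \<Rightarrow> bool" where
  "regular B \<longleftrightarrow> (\<exists>r. rlang r = B)"

text \<open>Letters of the extended alphabet: Inl a is the plain letter a,
  Inr a is the dotted copy of a.\<close>

definition ext_alph :: "nat set \<Rightarrow> (nat + nat) set" where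
  "ext_alph \<Sigma> = Inl ` \<Sigma> \<union> Inr ` \<Sigma>"

fun lmatch :: "nat + nat \<Rightarrow> nat + nat \<Rightarrow> (nat + nat) option" where
  "lmatch (Inl a) (Inr b) = (if a = b then Some (Inl a) else None)"
| "lmatch (Inr a) (Inl b) = (if a = b then Some (Inl a) else None)"
| "lmatch (Inr a) (Inr b) = (if a = b then Some (Inr a) else None)"
| "lmatch (Inl a) (Inl b) = None"

fun wmatch :: "(nat + nat) list \<Rightarrow> (nat + nat) list \<Rightarrow> (nat + nat) list option" where
  "wmatch [] [] = Some []"
| "wmatch (x # xs) (y # ys) =
     (case lmatch x y of None \<Rightarrow> None
      | Some z \<Rightarrow> (case wmatch xs ys of None \<Rightarrow> None | Some zs \<Rightarrow> Some (z # zs)))"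
| "wmatch _ _ = None"

definition langmatch :: "(nat + nat) list set \<Rightarrow> (nat + nat) list set \<Rightarrow> (nat + nat) list set" where
  "langmatch B1 B2 = {w. \<exists>w1\<in>B1. \<exists>w2\<in>B2. wmatch w1 w2 = Some w}"

fun mpow :: "(nat + nat) list set \<Rightarrow> nat \<Rightarrow> (nat + nat) list set" where
  "mpow B 0 = B"
| "mpow B (Suc i) = langmatch (mpow B i) B"

definition mstar :: "(nat + nat) list set \<Rightarrow> (nat + nat) list set" where
  "mstar B = (\<Union>i. mpow B i)"

text \<open>C(B) = B^@ intersected with \<Sigma>*, viewed as a language over \<Sigma>.\<close>
definition consensual :: "(nat + nat) list set \<Rightarrow> nat list set" where
  "consensual B = {x. map Inl x \<in> mstar B}"

definition CREG :: "nat set \<Rightarrow> nat list set set" where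
  "CREG \<Sigma> = {consensual B | B. B \<subseteq> lists (ext_alph \<Sigma>) \<and> regular B}"

end

(* A consensual word is spelled by a finite team of threads, each placing some of the positions.
   Label every occurrence of a letter by the number of earlier occurrences of that letter modulo m,
   and give each commutative linear factor its own label t > 0. One leader thread guesses the union
   component and the factorization and places everything except some occurrences with label t in the
   factor owning t; each fill thread places one period vector of that factor on occurrences with
   label t. Since the occurrences with label t are a fraction 1/m of the factor, up to bounded errors
   that the leader controls, matching them by periods decides the linear condition for the whole
   factor, while the fills never need to know the factorization. Label 0 is owned by no factor, so
   the first position is always placed by a leader, and exactly one leader takes part.

   Strictness: (01)^* is regular, but a commutative language of alternating words contains no word
   longer than 2, so alternating languages obtained by unions and concatenations are bounded in length. *)
theory Submission
  imports Defs "HOL-Library.Function_Algebras" "HOL-Library.FuncSet"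
begin

section \<open>Kleene's theorem and regularity by finite right congruences\<close>

section \<open>Regular languages\<close>

lemma regular_empty: "regular {}"
  unfolding regular_def by (metis rlang.simps(1))

lemma regular_Nil: "regular {[]}"
  unfolding regular_def by (metis rlang.simps(2))

lemma regular_single: "regular {[a]}"
  unfolding regular_def by (metis rlang.simps(3))

lemma regular_Un: "regular A \<Longrightarrow> regular B \<Longrightarrow> regular (A \<union> B)"
  unfolding regular_def by (metis rlang.simps(4))

lemma regular_conc: "regular A \<Longrightarrow> regular B \<Longrightarrow> regular (conc A B)"
  unfolding regular_def by (metis rlang.simps(5))

lemma regular_star: "regular A \<Longrightarrow> regular (\<Union>n. lpow A n)"
  unfolding regular_def by (metis rlang.simps(6))

lemma regular_UN:
  assumes "finite I" "\<And>i. i \<in> I \<Longrightarrow> regular (A i)"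
  shows "regular (\<Union>i\<in>I. A i)"
  using assms by (induction I rule: finite_induct) (auto intro: regular_empty regular_Un)

text \<open>Only the states strictly between the two ends of a path have to lie in \<open>X\<close>.\<close>
inductive path :: "('s \<Rightarrow> 'b \<Rightarrow> 's) \<Rightarrow> 'b set \<Rightarrow> 's set \<Rightarrow> 's \<Rightarrow> 'b list \<Rightarrow> 's \<Rightarrow> bool"
  for \<delta> A X where
  nil: "path \<delta> A X p [] p"
| one: "a \<in> A \<Longrightarrow> path \<delta> A X p [a] (\<delta> p a)"
| cons: "a \<in> A \<Longrightarrow> \<delta> p a \<in> X \<Longrightarrow> path \<delta> A X (\<delta> p a) w q \<Longrightarrow> path \<delta> A X p (a # w) q"

lemma path_mono: "path \<delta> A X p w q \<Longrightarrow> X \<subseteq> Y \<Longrightarrow> path \<delta> A Y p w q"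
  by (induction rule: path.induct) (auto intro: path.intros)

lemma path_append:
  "path \<delta> A X p u k \<Longrightarrow> k \<in> X \<Longrightarrow> path \<delta> A X k v q \<Longrightarrow> path \<delta> A X p (u @ v) q"
  by (induction rule: path.induct) (auto intro: path.intros)

lemma path_lpow:
  "w \<in> lpow {w. path \<delta> A X k w k} n \<Longrightarrow> k \<in> X \<Longrightarrow> path \<delta> A X k w k"
  by (induction n arbitrary: w) (auto simp: conc_def intro: path.intros path_append)

lemma lpow_mono: "A \<subseteq> B \<Longrightarrow> lpow A n \<subseteq> lpow B n"
  by (induction n) (auto simp: conc_def)

text \<open>Cutting a path at its intermediate visits to \<open>k\<close> leaves a first piece
  ending in \<open>k\<close>, loops at \<open>k\<close>, and a last piece starting in
  \<open>k\<close>, all with intermediate states in \<open>X\<close>.\<close>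

lemma path_insert:
  "path \<delta> A (insert k X) p w q \<longleftrightarrow> path \<delta> A X p w q \<or>
     (\<exists>u n s v. w = u @ s @ v \<and> path \<delta> A X p u k \<and>
        s \<in> lpow {w. path \<delta> A X k w k} n \<and> path \<delta> A X k v q)"
  (is "?L p w q \<longleftrightarrow> ?R p w q")
proof
  assume "?L p w q"
  then show "?R p w q"
  proof (induction rule: path.induct)
    case (cons a p w q)
    consider (direct) "path \<delta> A X (\<delta> p a) w q"
      | (via) u n s v where "w = u @ s @ v" "path \<delta> A X (\<delta> p a) u k"
        "s \<in> lpow {w. path \<delta> A X k w k} n" "path \<delta> A X k v q"
      using cons.IH by blast
    then show ?case
    proof cases
      case direct
      show ?thesis
      proof (cases "\<delta> p a \<in> X")
        case True
        then show ?thesis using direct cons.hyps by (blast intro: path.cons)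
      next
        \<comment> \<open>Here \<open>\<delta> p a\<close> is \<open>k\<close> itself: this visit
          ends the first piece, and there are no loops.\<close>
        case False
        then have "path \<delta> A X p [a] k" "path \<delta> A X k w q"
          using cons.hyps direct path.one[of a A \<delta> X p] by auto
        moreover have "[] \<in> lpow {w. path \<delta> A X k w k} 0" by simp
        moreover have "a # w = [a] @ [] @ w" by simp
        ultimately show ?thesis by blast
      qed
    next
      case via
      show ?thesis
      proof (cases "\<delta> p a \<in> X")
        case True
        then have "path \<delta> A X p (a # u) k" using via cons.hyps by (blast intro: path.cons)
        moreover have "a # w = (a # u) @ s @ v" using via by simp
        ultimately show ?thesis using via(3,4) by blast
      next
        \<comment> \<open>Again \<open>\<delta> p a = k\<close>, so the first piece of the remaining
          path becomes one more loop.\<close>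
        case False
        then have "path \<delta> A X p [a] k" "path \<delta> A X k u k"
          using cons.hyps via path.one[of a A \<delta> X p] by auto
        moreover from this via have "u @ s \<in> lpow {w. path \<delta> A X k w k} (Suc n)"
          by (auto simp: conc_def)
        moreover have "a # w = [a] @ (u @ s) @ v" using via by simp
        ultimately show ?thesis using via(4) by blast
      qed
    qed
  qed (auto intro: path.intros)
next
  assume "?R p w q"
  then consider (direct) "path \<delta> A X p w q"
    | (via) u n s v where "w = u @ s @ v" "path \<delta> A X p u k"
      "s \<in> lpow {w. path \<delta> A X k w k} n" "path \<delta> A X k v q"
    by blast
  then show "?L p w q"
  proof cases
    case direct
    then show ?thesis by (auto intro: path_mono)
  next
    case via
    have "{w. path \<delta> A X k w k} \<subseteq> {w. path \<delta> A (insert k X) k w k}"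
      using path_mono[of \<delta> A X k _ k "insert k X"] by blast
    then have "s \<in> lpow {w. path \<delta> A (insert k X) k w k} n"
      using via(3) lpow_mono by blast
    then have "path \<delta> A (insert k X) k s k" by (auto intro: path_lpow)
    moreover have "path \<delta> A (insert k X) p u k" "path \<delta> A (insert k X) k v q"
      using via path_mono[of \<delta> A X _ _ _ "insert k X"] by blast+
    ultimately show ?thesis using via(1) by (auto intro: path_append)
  qed
qed

lemma Collect_path_insert:
  "{w. path \<delta> A (insert k X) p w q} = {w. path \<delta> A X p w q} \<union>
     conc {w. path \<delta> A X p w k}
      (conc (\<Union>n. lpow {w. path \<delta> A X k w k} n) {w. path \<delta> A X k w q})"
  unfolding path_insert conc_def by blast

lemma regular_path:
  assumes "finite X" "finite A"
  shows "regular {w. path \<delta> A X p w q}"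
  using assms(1)
proof (induction X arbitrary: p q rule: finite_induct)
  case empty
  have eq: "{w. path \<delta> A {} p w q} =
      (if p = q then {[]} else {}) \<union> (\<Union>a\<in>{a \<in> A. \<delta> p a = q}. {[a]})"
    by (subst path.simps) (auto split: if_splits)
  have "regular (\<Union>a\<in>{a \<in> A. \<delta> p a = q}. {[a]})"
    using assms(2) by (intro regular_UN regular_single) simp
  moreover have "regular (if p = q then {[]} else {})"
    by (simp add: regular_Nil regular_empty)
  ultimately show ?case
    unfolding eq by (rule regular_Un[rotated])
next
  case (insert k X)
  show ?case
    unfolding Collect_path_insert
    by (rule regular_Un[OF insert.IH regular_conc[OF insert.IH
          regular_conc[OF regular_star[OF insert.IH] insert.IH]]])
qed

text \<open>One half of the Myhill-Nerode theorem: the values of \<open>f\<close> are the states of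
  a deterministic automaton, and hypothesis \<open>step\<close> makes transitions independent of the
  word chosen to represent a state.\<close>

lemma regular_finite_congruence:
  assumes "finite A" and fin: "finite (f ` lists A)"
    and step: "\<And>u v a. u \<in> lists A \<Longrightarrow> v \<in> lists A \<Longrightarrow> a \<in> A \<Longrightarrow> f u = f v \<Longrightarrow> f (u @ [a]) = f (v @ [a])"
  shows "regular {w \<in> lists A. f w = y}"
proof -
  define \<delta> where "\<delta> s a = f ((SOME w. w \<in> lists A \<and> f w = s) @ [a])" for s a
  have \<delta>: "\<delta> (f u) a = f (u @ [a])" if "u \<in> lists A" "a \<in> A" for u a
  proof -
    let ?w = "SOME w. w \<in> lists A \<and> f w = f u"
    have "?w \<in> lists A \<and> f ?w = f u" by (rule someI[of _ u]) (use that in simp)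
    then show ?thesis unfolding \<delta>_def using step that by blast
  qed
  let ?Q = "f ` lists A"
  have "path \<delta> A ?Q (f u) w (f (u @ w))" if "u \<in> lists A" "w \<in> lists A" for u w
    using that
  proof (induction w arbitrary: u)
    case (Cons a w)
    from Cons.IH[of "u @ [a]"] Cons.prems
    have "path \<delta> A ?Q (\<delta> (f u) a) w (f (u @ a # w))" by (simp add: \<delta>)
    moreover have "\<delta> (f u) a \<in> ?Q" unfolding \<delta>_def using Cons.prems \<delta>[of u a]
      by (auto simp: \<delta>_def intro!: imageI[of "u @ [a]"])
    ultimately show ?case using Cons.prems by (auto intro: path.cons)
  qed (auto intro: path.nil)
  from this[of "[]"] have 1: "path \<delta> A ?Q (f []) w (f w)" if "w \<in> lists A" for w
    using that by simp
  have 2: "w \<in> lists A \<and> q = f (u @ w)" if "path \<delta> A ?Q p w q" "p = f u" "u \<in> lists A" for p w q u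
    using that
  proof (induction arbitrary: u rule: path.induct)
    case (cons a p w q)
    have "\<delta> p a = f (u @ [a])" using \<delta>[OF cons.prems(2) cons.hyps(1)] cons.prems(1) by simp
    from cons.IH[OF this] show ?case using cons.prems(2) cons.hyps(1) by simp
  next
    case (one a p)
    then show ?case using \<delta>[OF one.prems(2) one.hyps] by simp
  qed simp
  have "{w \<in> lists A. f w = y} = {w. path \<delta> A ?Q (f []) w y}"
    using 1 2[OF _ refl, of "[]"] by (intro Collect_cong) (metis append_Nil lists.Nil)
  then show ?thesis using regular_path[OF fin assms(1)] by simp
qed

section \<open>Cyclic labels of occurrences and bounded counting\<close>

section \<open>Labelled occurrences\<close>

definition sym :: "nat + nat \<Rightarrow> nat" where
  "sym = case_sum (\<lambda>a. a) (\<lambda>a. a)"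

lemma sym_simps [simp]: "sym (Inl a) = a" "sym (Inr a) = a"
  by (simp_all add: sym_def)

lemma sym_in_iff: "l \<in> ext_alph \<Sigma> \<longleftrightarrow> sym l \<in> \<Sigma>"
  by (cases l) (auto simp: ext_alph_def)

lemma map_sym_in_lists_iff: "w \<in> lists (ext_alph \<Sigma>) \<longleftrightarrow> map sym w \<in> lists \<Sigma>"
  by (induction w) (auto simp: sym_in_iff)

text \<open>An offset \<open>e\<close> gives, for every letter \<open>a\<close>, the label modulo \<open>m\<close> of the next occurrence of \<open>a\<close>;
  consecutive occurrences of a letter carry cyclically consecutive labels.\<close>

definition step :: "nat \<Rightarrow> (nat \<Rightarrow> nat) \<Rightarrow> nat \<Rightarrow> nat \<Rightarrow> nat" where
  "step m e a = e(a := Suc (e a) mod m)"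

definition off :: "nat \<Rightarrow> (nat \<Rightarrow> nat) \<Rightarrow> (nat + nat) list \<Rightarrow> nat \<Rightarrow> nat" where
  "off m e w = foldl (step m) e (map sym w)"

lemma off_simps [simp]:
  "off m e [] = e" "off m e (l # w) = off m (step m e (sym l)) w"
  "off m e (u @ v) = off m (off m e u) v"
  by (simp_all add: off_def)

fun cnt :: "nat \<Rightarrow> (nat + nat \<Rightarrow> nat \<Rightarrow> bool) \<Rightarrow> (nat \<Rightarrow> nat) \<Rightarrow> (nat + nat) list \<Rightarrow> nat \<Rightarrow> nat" where
  "cnt m Q e [] = 0"
| "cnt m Q e (l # w) =
     (\<lambda>a. if a = sym l \<and> Q l (e a) then 1 else 0) + cnt m Q (step m e (sym l)) w"

lemma cnt_append: "cnt m Q e (u @ v) = cnt m Q e u + cnt m Q (off m e u) v"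
  by (induction u arbitrary: e) (simp_all add: add.assoc)

lemma cnt_eq_0_mono:
  assumes "cnt m Q e w = 0" "\<And>l x. R l x \<Longrightarrow> Q l x"
  shows "cnt m R e w = 0"
  using assms(1)
proof (induction w arbitrary: e)
  case (Cons l w)
  then have "\<not> Q l (e (sym l))" "cnt m Q (step m e (sym l)) w = 0"
    by (auto simp: fun_eq_iff split: if_splits)
  then show ?case using Cons.IH assms(2) by (auto simp: fun_eq_iff)
qed simp

lemma cnt_disj:
  assumes "\<And>l x. \<not> (Q l x \<and> R l x)"
  shows "cnt m (\<lambda>l x. Q l x \<or> R l x) e w = cnt m Q e w + cnt m R e w"
  using assms by (induction w arbitrary: e) (auto simp: fun_eq_iff)

lemma cnt_outside: "map sym w \<in> lists \<Sigma> \<Longrightarrow> a \<notin> \<Sigma> \<Longrightarrow> cnt m Q e w a = 0"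
  by (induction w arbitrary: e) auto

abbreviation placed :: "nat \<Rightarrow> nat \<Rightarrow> (nat \<Rightarrow> nat) \<Rightarrow> (nat + nat) list \<Rightarrow> nat \<Rightarrow> nat" where
  "placed m t \<equiv> cnt m (\<lambda>l x. isl l \<and> x = t)"

abbreviation dotted :: "nat \<Rightarrow> nat \<Rightarrow> (nat \<Rightarrow> nat) \<Rightarrow> (nat + nat) list \<Rightarrow> nat \<Rightarrow> nat" where
  "dotted m t \<equiv> cnt m (\<lambda>l x. \<not> isl l \<and> x = t)"

abbreviation placed_off :: "nat \<Rightarrow> nat \<Rightarrow> (nat \<Rightarrow> nat) \<Rightarrow> (nat + nat) list \<Rightarrow> nat \<Rightarrow> nat" where
  "placed_off m t \<equiv> cnt m (\<lambda>l x. isl l \<and> x \<noteq> t)"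

abbreviation dotted_off :: "nat \<Rightarrow> nat \<Rightarrow> (nat \<Rightarrow> nat) \<Rightarrow> (nat + nat) list \<Rightarrow> nat \<Rightarrow> nat" where
  "dotted_off m t \<equiv> cnt m (\<lambda>l x. \<not> isl l \<and> x \<noteq> t)"

abbreviation occs :: "nat \<Rightarrow> nat \<Rightarrow> (nat \<Rightarrow> nat) \<Rightarrow> (nat + nat) list \<Rightarrow> nat \<Rightarrow> nat" where
  "occs m t \<equiv> cnt m (\<lambda>l x. x = t)"

lemma occs_split: "occs m t e w = placed m t e w + dotted m t e w"
proof -
  have "(\<lambda>(l :: nat + nat) x. x = t) = (\<lambda>l x. isl l \<and> x = t \<or> \<not> isl l \<and> x = t)"
    by auto
  then show ?thesis by (simp only: cnt_disj) (rule cnt_disj, auto)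
qed

lemma dotted_zeroI: "dotted_off m t e w = 0 \<Longrightarrow> t' \<noteq> t \<Longrightarrow> dotted m t' e w = 0"
  by (erule cnt_eq_0_mono) auto

lemma placed_zeroI: "placed_off m t e w = 0 \<Longrightarrow> t' \<noteq> t \<Longrightarrow> placed m t' e w = 0"
  by (erule cnt_eq_0_mono) auto

lemma occs_cong: "map sym u = map sym v \<Longrightarrow> occs m t e u = occs m t e v"
proof (induction u arbitrary: v e)
  case (Cons l u)
  then obtain k w where "v = k # w" "sym l = sym k" "map sym u = map sym w"
    by (cases v) auto
  then show ?case using Cons.IH[of w] by simp
qed simp

definition offs :: "nat set \<Rightarrow> nat \<Rightarrow> (nat \<Rightarrow> nat) set" where
  "offs \<Sigma> m = {e. \<forall>a. if a \<in> \<Sigma> then e a < m else e a = 0}"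

lemma finite_bounded_support:
  assumes "finite \<Sigma>"
  shows "finite {e :: nat \<Rightarrow> nat. \<forall>a. if a \<in> \<Sigma> then e a \<le> d a else e a = 0}"
proof (rule finite_subset)
  show "{e. \<forall>a. if a \<in> \<Sigma> then e a \<le> d a else e a = 0}
      \<subseteq> (\<lambda>f a. if a \<in> \<Sigma> then f a else 0) ` (PiE \<Sigma> (\<lambda>a. {..d a}))"
  proof
    fix e assume e: "e \<in> {e. \<forall>a. if a \<in> \<Sigma> then e a \<le> d a else e a = 0}"
    then have "e = (\<lambda>a. if a \<in> \<Sigma> then restrict e \<Sigma> a else 0)"
      by (auto simp: fun_eq_iff)
    moreover have "restrict e \<Sigma> \<in> PiE \<Sigma> (\<lambda>a. {..d a})"
      using e by auto
    ultimately show "e \<in> (\<lambda>f a. if a \<in> \<Sigma> then f a else 0) ` (PiE \<Sigma> (\<lambda>a. {..d a}))"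
      by blast
  qed
qed (use assms in \<open>auto intro: finite_PiE\<close>)

lemma finite_offs: "finite \<Sigma> \<Longrightarrow> finite (offs \<Sigma> m)"
  by (rule finite_subset[OF _ finite_bounded_support[of \<Sigma> "\<lambda>_. m"]])
    (auto simp: offs_def split: if_splits dest: spec)

lemma off_in_offs: "e \<in> offs \<Sigma> m \<Longrightarrow> w \<in> lists (ext_alph \<Sigma>) \<Longrightarrow> off m e w \<in> offs \<Sigma> m"
proof (induction w arbitrary: e)
  case (Cons l w)
  from Cons.prems have "sym l \<in> \<Sigma>" by (auto simp: sym_in_iff)
  then have "step m e (sym l) \<in> offs \<Sigma> m"
    using Cons.prems(1) by (auto simp: offs_def step_def split: if_splits)
      (metis gr_implies_not0 mod_less_divisor neq0_conv)+
  then show ?case using Cons by simp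
qed simp

text \<open>A saturating counter: a fixed value can be tested with finite memory, because all
  vectors not below \<open>d\<close> are identified.\<close>

definition cap :: "(nat \<Rightarrow> nat) \<Rightarrow> (nat \<Rightarrow> nat) \<Rightarrow> (nat \<Rightarrow> nat) option" where
  "cap d v = (if v \<le> d then Some v else None)"

text \<open>Addition never brings a coordinate that exceeds its bound back below it.\<close>

lemma cap_add: "cap d u = cap d v \<Longrightarrow> cap d (u + w) = cap d (v + w)"
proof -
  have "\<not> u + w \<le> d" if "\<not> u \<le> d" for u :: "nat \<Rightarrow> nat"
    using that by (auto simp: le_fun_def) (meson add_leE)
  then show "cap d u = cap d v \<Longrightarrow> cap d (u + w) = cap d (v + w)"
    by (auto simp: cap_def split: if_splits)
qed

text \<open>The offset with two saturated counters is a right congruence of finite index; each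
  counter saturates just above the value to be tested.\<close>

lemma regular_cnt:
  assumes "finite \<Sigma>" "e \<in> offs \<Sigma> m"
  shows "regular {w \<in> lists (ext_alph \<Sigma>). off m e w = e' \<and> cnt m Q e w = c \<and> cnt m R e w = d}"
proof -
  let ?f = "\<lambda>w. (off m e w, cap c (cnt m Q e w), cap d (cnt m R e w))"
  let ?B = "\<lambda>d. insert None (Some ` {v :: nat \<Rightarrow> nat. \<forall>a. if a \<in> \<Sigma> then v a \<le> d a else v a = 0})"
  have cap: "cap d (cnt m Q e w) \<in> ?B d" if "w \<in> lists (ext_alph \<Sigma>)" for d Q w
    using that cnt_outside[of w \<Sigma>] by (auto simp: cap_def le_fun_def map_sym_in_lists_iff)
  have "?f ` lists (ext_alph \<Sigma>) \<subseteq> offs \<Sigma> m \<times> ?B c \<times> ?B d"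
    using cap off_in_offs[OF assms(2)] by blast
  moreover have "finite (offs \<Sigma> m \<times> ?B c \<times> ?B d)"
    using assms finite_offs finite_bounded_support by (intro finite_cartesian_product finite.insertI finite_imageI)
  ultimately have fin: "finite (?f ` lists (ext_alph \<Sigma>))" by (rule finite_subset)
  have "?f (u @ [a]) = ?f (v @ [a])"
    if "u \<in> lists (ext_alph \<Sigma>)" "v \<in> lists (ext_alph \<Sigma>)" "a \<in> ext_alph \<Sigma>" "?f u = ?f v" for u v a
    using that(4) by (auto simp: cnt_append intro: cap_add)
  moreover have "finite (ext_alph \<Sigma>)" using assms(1) by (simp add: ext_alph_def)
  ultimately have "regular {w \<in> lists (ext_alph \<Sigma>). ?f w = (e', Some c, Some d)}"
    by (rule regular_finite_congruence[OF _ fin, rotated])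
  moreover have "?f w = (e', Some c, Some d) \<longleftrightarrow> off m e w = e' \<and> cnt m Q e w = c \<and> cnt m R e w = d" for w
    by (auto simp: cap_def split: if_splits)
  ultimately show ?thesis by simp
qed

text \<open>A full cycle of \<open>m\<close> occurrences of \<open>a\<close> meets label
  \<open>t\<close> exactly once; the indicator terms correct for the incomplete cycles at both ends.
  The additive form avoids subtraction of naturals.\<close>

lemma count_occs:
  assumes "e \<in> offs \<Sigma> m" "w \<in> lists (ext_alph \<Sigma>)" "t < m"
  shows "count_list (map sym w) a + e a + m * of_bool (t < off m e w a)
     = off m e w a + m * occs m t e w a + m * of_bool (t < e a)"
  using assms(1,2)
proof (induction w arbitrary: e)
  case (Cons l w)
  from Cons.prems have l: "sym l \<in> \<Sigma>" by (auto simp: sym_in_iff)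
  have "step m e (sym l) \<in> offs \<Sigma> m" using off_in_offs[of e \<Sigma> m "[l]"] Cons.prems by simp
  note IH = Cons.IH[OF this] 
  have "e a < m" if "sym l = a" using Cons.prems(1) l that by (auto simp: offs_def split: if_splits)
  \<comment> \<open>The offset grows by one, except at \<open>Suc (e a) = m\<close>, where it drops
    to 0 and the indicator terms absorb the jump by \<open>m\<close>.\<close>
  then have "of_bool (sym l = a) + e a + m * of_bool (t < step m e (sym l) a)
     = step m e (sym l) a + m * of_bool (sym l = a \<and> e a = t) + m * of_bool (t < e a)"
    using assms(3) by (cases "Suc (e a) = m") (auto simp: step_def)
  then show ?case using IH Cons.prems(2) by (auto simp: algebra_simps split: if_splits)
qed simp

lemma occs_ge:
  assumes "e \<in> offs \<Sigma> m" "w \<in> lists (ext_alph \<Sigma>)" "t < m"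
    "m * y \<le> count_list (map sym w) a"
  shows "y \<le> occs m t e w a"
proof (cases "a \<in> \<Sigma>")
  case True
  then have "e a < m" "off m e w a < m"
    using assms(1) off_in_offs[OF assms(1,2)] by (auto simp: offs_def split: if_splits)
  \<comment> \<open>The incomplete cycles contribute less than \<open>m\<close> beyond
    \<open>m\<close> times the number of occurrences with label \<open>t\<close>.\<close>
  then have "m * y < m * occs m t e w a + m"
    using count_occs[OF assms(1-3), of a] assms(4) by (auto simp: of_bool_def split: if_splits)
  then have "m * y < m * Suc (occs m t e w a)" by simp
  then have "y < Suc (occs m t e w a)" by (simp only: mult_less_cancel1)
  then show ?thesis by simp
next
  case False
  then have "count_list (map sym w) a = 0"
    using assms(2) by (auto simp: count_list_0_iff sym_in_iff)
  then show ?thesis using assms(3,4) by simp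
qed

section \<open>Matching words, and the monoid generated by a set of vectors\<close>

section \<open>Matching\<close>

lemma wmatch_sym:
  "wmatch u v = Some z \<Longrightarrow> map sym u = map sym z \<and> map sym v = map sym z"
proof (induction u v arbitrary: z rule: wmatch.induct)
  case (2 x xs y ys)
  then show ?case
    by (cases x; cases y) (auto split: option.splits if_splits)
qed auto

lemma wmatch_placed:
  "wmatch u v = Some z \<Longrightarrow> placed m t e z = placed m t e u + placed m t e v"
proof (induction u v arbitrary: z e rule: wmatch.induct)
  case (2 x xs y ys)
  then show ?case
    by (cases x; cases y) (auto split: option.splits if_splits simp: fun_eq_iff)
qed auto

text \<open>An occurrence dotted in one of the words either stays dotted in the match or is placed
  by the other word.\<close>

lemma wmatch_dotted:
  assumes "wmatch u v = Some z"
  shows "dotted m t e u = dotted m t e z + placed m t e v"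
    and "dotted m t e v = dotted m t e z + placed m t e u"
proof -
  have "occs m t e u = occs m t e z" "occs m t e v = occs m t e z"
    using wmatch_sym[OF assms] by (auto intro: occs_cong)
  then show "dotted m t e u = dotted m t e z + placed m t e v"
    "dotted m t e v = dotted m t e z + placed m t e u"
    using wmatch_placed[OF assms, of m t e] by (auto simp: occs_split fun_eq_iff)
qed

text \<open>Greedy choice from left to right: place a dotted occurrence with label \<open>t\<close>
  as long as \<open>p\<close> still asks for its letter.\<close>

lemma wmatch_choose:
  assumes "p \<le> dotted m t e z"
  obtains w z' where "wmatch z w = Some z'" "placed m t e w = p" "placed_off m t e w = 0"
  using assms
proof (induction z arbitrary: e p thesis)
  case Nil
  then have "p = 0" by (auto simp: le_fun_def fun_eq_iff)
  then show ?case using Nil(1)[of "[]" "[]"] by simp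
next
  case (Cons l z)
  let ?a = "sym l"
  show ?case
  proof (cases "\<not> isl l \<and> e ?a = t \<and> p ?a > 0")
    case True
    have "p(?a := p ?a - 1) \<le> dotted m t (step m e ?a) z"
      using Cons.prems(2) True unfolding le_fun_def
      by (intro allI) (drule_tac x = x in spec, auto)
    then obtain w z' where w: "wmatch z w = Some z'"
      "placed m t (step m e ?a) w = p(?a := p ?a - 1)" "placed_off m t (step m e ?a) w = 0"
      using Cons.IH by blast
    show ?thesis
      by (rule Cons.prems(1)[of "Inl ?a # w" "Inl ?a # z'"])
        (use w True in \<open>cases l; auto simp: fun_eq_iff\<close>)+
  next
    \<comment> \<open>This position keeps its status in \<open>z'\<close>: it is not a dotted
      occurrence with label \<open>t\<close>, or \<open>p\<close> asks for no more copies of its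
      letter.\<close>
    case False
    have "p \<le> dotted m t (step m e ?a) z"
    proof (rule le_funI)
      fix a
      have "p a \<le> dotted m t e (l # z) a" using Cons.prems(2) by (simp only: le_fun_def)
      then show "p a \<le> dotted m t (step m e ?a) z a" using False by (auto split: if_splits)
    qed
    then obtain w z' where w: "wmatch z w = Some z'"
      "placed m t (step m e ?a) w = p" "placed_off m t (step m e ?a) w = 0"
      using Cons.IH by blast
    show ?thesis
      by (rule Cons.prems(1)[of "Inr ?a # w" "l # z'"])
        (use w in \<open>cases l; auto simp: fun_eq_iff\<close>)+
  qed
qed

text \<open>The additive submonoid generated by \<open>P\<close>; one use of \<open>add\<close> is
  the contribution of one fill.\<close>

inductive_set cone :: "(nat \<Rightarrow> nat) set \<Rightarrow> (nat \<Rightarrow> nat) set" for P where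
  zero: "0 \<in> cone P"
| add: "p \<in> P \<Longrightarrow> y \<in> cone P \<Longrightarrow> p + y \<in> cone P"

lemma cone_plus: "x \<in> cone P \<Longrightarrow> y \<in> cone P \<Longrightarrow> x + y \<in> cone P"
  by (induction rule: cone.induct) (auto simp: add.assoc intro: cone.intros)

lemma cone_empty: "y \<in> cone {} \<longleftrightarrow> y = 0"
  by (auto elim: cone.cases intro: cone.zero)

section \<open>Slottings and their closure under union and concatenation\<close>

section \<open>Leaders and fills\<close>

text \<open>\<open>slotting \<Sigma> m S L Lead P\<close>: a word of \<open>L\<close> is spelled by a leader which leaves dotted only
  occurrences with labels in \<open>S\<close>; those with label \<open>t\<close> are left to the fills, whose Parikh vectors
  are listed in \<open>P t\<close>. As \<open>Lead\<close> depends on the offset, leaders can be concatenated, while the fills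
  never need to know where a factor begins or ends.\<close>

definition slotting :: "nat set \<Rightarrow> nat \<Rightarrow> nat set \<Rightarrow> nat list set \<Rightarrow>
    ((nat \<Rightarrow> nat) \<Rightarrow> (nat + nat) list set) \<Rightarrow> (nat \<Rightarrow> (nat \<Rightarrow> nat) set) \<Rightarrow> bool" where
  "slotting \<Sigma> m S L Lead P \<longleftrightarrow>
     (\<forall>t. finite (P t) \<and> 0 \<notin> P t) \<and> (\<forall>t. t \<notin> S \<longrightarrow> P t = {}) \<and>
     (\<forall>e\<in>offs \<Sigma> m. Lead e \<subseteq> lists (ext_alph \<Sigma>) \<and>
       (\<forall>e'\<in>offs \<Sigma> m. regular {s \<in> Lead e. off m e s = e'}) \<and>
       (\<forall>s\<in>Lead e. \<forall>t. t \<notin> S \<longrightarrow> dotted m t e s = 0) \<and>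
       L = {map sym s | s. s \<in> Lead e \<and> (\<forall>t. dotted m t e s \<in> cone (P t))})"

text \<open>The block of labels may start anywhere and the modulus may grow, so that languages
  combined later can share one modulus and own disjoint blocks.\<close>

definition slotted :: "nat set \<Rightarrow> nat list set \<Rightarrow> bool" where
  "slotted \<Sigma> L \<longleftrightarrow>
     (\<exists>n. \<forall>m b. b + n \<le> m \<longrightarrow> (\<exists>Lead P. slotting \<Sigma> m {b..<b + n} L Lead P))"

lemma slottingD:
  assumes "slotting \<Sigma> m S L Lead P"
  shows "finite (P t)" "0 \<notin> P t" "t \<notin> S \<Longrightarrow> P t = {}"
    and "e \<in> offs \<Sigma> m \<Longrightarrow> Lead e \<subseteq> lists (ext_alph \<Sigma>)"
    and "e \<in> offs \<Sigma> m \<Longrightarrow> e' \<in> offs \<Sigma> m \<Longrightarrow> regular {s \<in> Lead e. off m e s = e'}"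
    and "e \<in> offs \<Sigma> m \<Longrightarrow> s \<in> Lead e \<Longrightarrow> t \<notin> S \<Longrightarrow> dotted m t e s = 0"
    and "e \<in> offs \<Sigma> m \<Longrightarrow> L = {map sym s | s. s \<in> Lead e \<and> (\<forall>t. dotted m t e s \<in> cone (P t))}"
  using assms unfolding slotting_def by blast+

lemma slotted_combine:
  assumes "slotted \<Sigma> L1" "slotted \<Sigma> L2"
    and "\<And>m S1 S2 Lead1 P1 Lead2 P2. slotting \<Sigma> m S1 L1 Lead1 P1 \<Longrightarrow> slotting \<Sigma> m S2 L2 Lead2 P2 \<Longrightarrow>
      S1 \<inter> S2 = {} \<Longrightarrow> \<exists>Lead P. slotting \<Sigma> m (S1 \<union> S2) L Lead P"
  shows "slotted \<Sigma> L"
proof -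
  obtain n1 n2 where
    n1: "\<And>m b. b + n1 \<le> m \<Longrightarrow> \<exists>Lead P. slotting \<Sigma> m {b..<b + n1} L1 Lead P" and
    n2: "\<And>m b. b + n2 \<le> m \<Longrightarrow> \<exists>Lead P. slotting \<Sigma> m {b..<b + n2} L2 Lead P"
    using assms(1,2) unfolding slotted_def by blast
  have "\<exists>Lead P. slotting \<Sigma> m {b..<b + (n1 + n2)} L Lead P" if "b + (n1 + n2) \<le> m" for m b
  proof -
    from that have "b + n1 \<le> m" "(b + n1) + n2 \<le> m" by auto
    from n1[OF this(1)] n2[OF this(2)] obtain Lead1 P1 Lead2 P2 where
      "slotting \<Sigma> m {b..<b + n1} L1 Lead1 P1" "slotting \<Sigma> m {b + n1..<b + n1 + n2} L2 Lead2 P2"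
      by blast
    moreover have "{b..<b + (n1 + n2)} = {b..<b + n1} \<union> {b + n1..<b + n1 + n2}" by auto
    ultimately show ?thesis using assms(3) by fastforce
  qed
  then show ?thesis unfolding slotted_def by blast
qed

lemma slotted_empty: "slotted \<Sigma> {}"
  unfolding slotted_def slotting_def
  by (rule exI[of _ 0], intro allI impI exI[of _ "\<lambda>_. {}"]) (simp add: regular_empty)

text \<open>A leader of one component leaves nothing dotted on the labels of the other, and zero
  lies in every cone, so the other component's periods impose no condition on it.\<close>

lemma slotting_Un:
  assumes 1: "slotting \<Sigma> m S1 L1 Lead1 P1" and 2: "slotting \<Sigma> m S2 L2 Lead2 P2"
    and "S1 \<inter> S2 = {}"
  shows "slotting \<Sigma> m (S1 \<union> S2) (L1 \<union> L2)
    (\<lambda>e. Lead1 e \<union> Lead2 e) (\<lambda>t. if t \<in> S1 then P1 t else P2 t)"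
  unfolding slotting_def
proof (intro conjI ballI)
  let ?P = "\<lambda>t. if t \<in> S1 then P1 t else P2 t"
  show "\<forall>t. finite (?P t) \<and> 0 \<notin> ?P t" "\<forall>t. t \<notin> S1 \<union> S2 \<longrightarrow> ?P t = {}"
    using slottingD(1-3)[OF 1] slottingD(1-3)[OF 2] by auto
  fix e assume e: "e \<in> offs \<Sigma> m"
  show "Lead1 e \<union> Lead2 e \<subseteq> lists (ext_alph \<Sigma>)"
    using slottingD(4)[OF 1 e] slottingD(4)[OF 2 e] by blast
  show "\<forall>t. t \<notin> S1 \<union> S2 \<longrightarrow> dotted m t e s = 0" if "s \<in> Lead1 e \<union> Lead2 e" for s
    using slottingD(6)[OF 1 e] slottingD(6)[OF 2 e] that by blast
  have "dotted m t e s \<in> cone (?P t) \<longleftrightarrow> dotted m t e s \<in> cone (P1 t)" if "s \<in> Lead1 e" for s t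
    using slottingD(6)[OF 1 e that, of t] by (auto intro: cone.zero)
  moreover have "dotted m t e s \<in> cone (?P t) \<longleftrightarrow> dotted m t e s \<in> cone (P2 t)" if "s \<in> Lead2 e" for s t
  proof (cases "t \<in> S1")
    case True
    then have "dotted m t e s = 0" using slottingD(6)[OF 2 e that] assms(3) by blast
    then show ?thesis by (simp add: cone.zero)
  qed simp
  moreover note slottingD(7)[OF 1 e] slottingD(7)[OF 2 e]
  ultimately show "L1 \<union> L2 =
      {map sym s | s. s \<in> Lead1 e \<union> Lead2 e \<and> (\<forall>t. dotted m t e s \<in> cone (?P t))}"
    by blast
  fix e' assume e': "e' \<in> offs \<Sigma> m"
  have "{s \<in> Lead1 e \<union> Lead2 e. off m e s = e'} =
      {s \<in> Lead1 e. off m e s = e'} \<union> {s \<in> Lead2 e. off m e s = e'}" by blast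
  then show "regular {s \<in> Lead1 e \<union> Lead2 e. off m e s = e'}"
    using slottingD(5)[OF 1 e e'] slottingD(5)[OF 2 e e'] by (simp add: regular_Un)
qed

text \<open>The second leader starts at the offset where the first one ends. As the blocks are
  disjoint, all dotted occurrences with a given label lie in one factor, so the cone conditions
  separate.\<close>

lemma slotting_conc:
  assumes 1: "slotting \<Sigma> m S1 L1 Lead1 P1" and 2: "slotting \<Sigma> m S2 L2 Lead2 P2"
    and "S1 \<inter> S2 = {}" "finite \<Sigma>"
  shows "slotting \<Sigma> m (S1 \<union> S2) (conc L1 L2)
    (\<lambda>e. {u @ v | u v. u \<in> Lead1 e \<and> v \<in> Lead2 (off m e u)}) (\<lambda>t. if t \<in> S1 then P1 t else P2 t)"
  unfolding slotting_def
proof (intro conjI ballI)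
  let ?P = "\<lambda>t. if t \<in> S1 then P1 t else P2 t"
  let ?Lead = "\<lambda>e. {u @ v | u v. u \<in> Lead1 e \<and> v \<in> Lead2 (off m e u)}"
  show "\<forall>t. finite (?P t) \<and> 0 \<notin> ?P t" "\<forall>t. t \<notin> S1 \<union> S2 \<longrightarrow> ?P t = {}"
    using slottingD(1-3)[OF 1] slottingD(1-3)[OF 2] by auto
  fix e assume e: "e \<in> offs \<Sigma> m"
  have off: "off m e u \<in> offs \<Sigma> m" if "u \<in> Lead1 e" for u
    using off_in_offs[OF e] slottingD(4)[OF 1 e] that by blast
  show "?Lead e \<subseteq> lists (ext_alph \<Sigma>)"
    using slottingD(4)[OF 1 e] slottingD(4)[OF 2 off] by fastforce
  show "\<forall>t. t \<notin> S1 \<union> S2 \<longrightarrow> dotted m t e s = 0" if "s \<in> ?Lead e" for s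
    using slottingD(6)[OF 1 e] slottingD(6)[OF 2 off] that by (auto simp: cnt_append)
  have c: "(\<forall>t. dotted m t e (u @ v) \<in> cone (?P t)) \<longleftrightarrow>
      (\<forall>t. dotted m t e u \<in> cone (P1 t)) \<and> (\<forall>t. dotted m t (off m e u) v \<in> cone (P2 t))"
    if "u \<in> Lead1 e" "v \<in> Lead2 (off m e u)" for u v
  proof -
    have u: "dotted m t e u = 0" if "t \<notin> S1" for t
      using slottingD(6)[OF 1 e] \<open>u \<in> Lead1 e\<close> that by blast
    have v: "dotted m t (off m e u) v = 0" if "t \<in> S1" for t
      using slottingD(6)[OF 2 off] \<open>u \<in> Lead1 e\<close> \<open>v \<in> Lead2 (off m e u)\<close> that assms(3) by blast
    have "dotted m t e (u @ v) \<in> cone (?P t) \<longleftrightarrow>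
       dotted m t e u \<in> cone (P1 t) \<and> dotted m t (off m e u) v \<in> cone (P2 t)" for t
      using u[of t] v[of t] by (cases "t \<in> S1") (simp_all add: cnt_append cone.zero)
    then show ?thesis by blast
  qed
  show "conc L1 L2 = {map sym s | s. s \<in> ?Lead e \<and> (\<forall>t. dotted m t e s \<in> cone (?P t))}"
  proof (intro equalityI subsetI)
    fix x assume "x \<in> conc L1 L2"
    then obtain y z where x: "x = y @ z" "y \<in> L1" "z \<in> L2" by (auto simp: conc_def)
    then obtain u where u: "y = map sym u" "u \<in> Lead1 e" "\<forall>t. dotted m t e u \<in> cone (P1 t)"
      using slottingD(7)[OF 1 e] by blast
    obtain v where v: "z = map sym v" "v \<in> Lead2 (off m e u)"
      "\<forall>t. dotted m t (off m e u) v \<in> cone (P2 t)"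
      using slottingD(7)[OF 2 off[OF u(2)]] x(3) by blast
    have "x = map sym (u @ v)" using x(1) u(1) v(1) by simp
    moreover have "u @ v \<in> ?Lead e" using u(2) v(2) by blast
    moreover have "\<forall>t. dotted m t e (u @ v) \<in> cone (?P t)" using c[OF u(2) v(2)] u(3) v(3) by blast
    ultimately show "x \<in> {map sym s | s. s \<in> ?Lead e \<and> (\<forall>t. dotted m t e s \<in> cone (?P t))}" by blast
  next
    fix x assume "x \<in> {map sym s | s. s \<in> ?Lead e \<and> (\<forall>t. dotted m t e s \<in> cone (?P t))}"
    then obtain u v where uv: "x = map sym (u @ v)" "u \<in> Lead1 e" "v \<in> Lead2 (off m e u)"
      "\<forall>t. dotted m t e (u @ v) \<in> cone (?P t)" by blast
    then have "map sym u \<in> L1" "map sym v \<in> L2"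
      using c[OF uv(2,3)] slottingD(7)[OF 1 e] slottingD(7)[OF 2 off[OF uv(2)]] by blast+
    then show "x \<in> conc L1 L2" using uv(1) by (auto simp: conc_def)
  qed
  fix e' assume e': "e' \<in> offs \<Sigma> m"
  \<comment> \<open>Splitting by the offset at the cut gives a finite union of concatenations; hence
    a slotting asks for regularity separately at each final offset.\<close>
  have "{s \<in> ?Lead e. off m e s = e'} = (\<Union>d\<in>offs \<Sigma> m.
      conc {u \<in> Lead1 e. off m e u = d} {v \<in> Lead2 d. off m d v = e'})" (is "?A = ?B")
  proof (intro equalityI subsetI)
    fix s assume "s \<in> ?A"
    then obtain u v where "s = u @ v" "u \<in> Lead1 e" "v \<in> Lead2 (off m e u)" "off m (off m e u) v = e'"
      by auto
    then show "s \<in> ?B" using off by (intro UN_I[of "off m e u"]) (auto simp: conc_def)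
  qed (auto simp: conc_def)
  then show "regular {s \<in> ?Lead e. off m e s = e'}"
    using slottingD(5)[OF 1 e] slottingD(5)[OF 2 _ e'] finite_offs[OF assms(4)]
    by (simp only: regular_UN regular_conc)
qed

lemma slotted_Un: "slotted \<Sigma> L1 \<Longrightarrow> slotted \<Sigma> L2 \<Longrightarrow> slotted \<Sigma> (L1 \<union> L2)"
  by (rule slotted_combine) (blast intro: slotting_Un)+

lemma slotted_conc: "finite \<Sigma> \<Longrightarrow> slotted \<Sigma> L1 \<Longrightarrow> slotted \<Sigma> L2 \<Longrightarrow> slotted \<Sigma> (conc L1 L2)"
  by (rule slotted_combine) (blast intro: slotting_conc)+

section \<open>Commutative languages with linear and semilinear Parikh images\<close>

section \<open>Commutative semilinear languages\<close>

abbreviation lin :: "(nat \<Rightarrow> nat) \<Rightarrow> (nat \<Rightarrow> nat) list \<Rightarrow> (nat \<Rightarrow> nat) \<Rightarrow> nat \<Rightarrow> nat" where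
  "lin c ps n \<equiv> \<lambda>a. c a + (\<Sum>i<length ps. n i * (ps ! i) a)"

text \<open>Each generator summed in \<open>y\<close> raises the coefficient of one period by
  \<open>m\<close>.\<close>

lemma lin_plus_cone:
  assumes "y \<in> cone (set ps - {0})"
  shows "\<exists>n'. lin c ps n + (\<lambda>a. m * y a) = lin c ps n'"
  using assms
proof (induction arbitrary: n rule: cone.induct)
  case zero
  show ?case by (rule exI[of _ n]) (simp add: fun_eq_iff)
next
  case (add p y)
  then obtain i where i: "i < length ps" "ps ! i = p" by (auto simp: in_set_conv_nth)
  let ?n = "n(i := n i + m)"
  have "lin c ps ?n a = lin c ps n a + m * p a" for a
  proof -
    have "(\<Sum>j<length ps. ?n j * (ps ! j) a)
        = (\<Sum>j<length ps. n j * (ps ! j) a + (if j = i then m * p a else 0))"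
      using i by (intro sum.cong) (auto simp: algebra_simps)
    then show ?thesis using i by (simp add: sum.distrib)
  qed
  moreover obtain n' where "lin c ps ?n + (\<lambda>a. m * y a) = lin c ps n'" using add.IH by blast
  ultimately show ?case
    by (intro exI[of _ n']) (auto simp: fun_eq_iff algebra_simps)
qed

lemma lin_in_cone: "(\<lambda>a. \<Sum>i<k. n i * (ps ! i) a) \<in> cone (set ps - {0})" if "k \<le> length ps"
proof -
  have mult: "(\<lambda>a. j * p a) \<in> cone (set ps - {0})" if "p \<in> set ps" for j p
  proof (induction j)
    case 0
    then show ?case using cone.zero by (simp add: zero_fun_def)
  next
    case (Suc j)
    have "(\<lambda>a. Suc j * p a) = p + (\<lambda>a. j * p a)" by (simp add: fun_eq_iff)
    show ?case
    proof (cases "p = 0")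
      case True
      then have "(\<lambda>a. Suc j * p a) = 0" by (simp add: fun_eq_iff)
      then show ?thesis by (simp only: cone.zero)
    next
      case False
      then have "p \<in> set ps - {0}" using that by blast
      then show ?thesis using Suc unfolding \<open>(\<lambda>a. Suc j * p a) = _\<close> by (rule cone.add)
    qed
  qed
  show ?thesis using that
  proof (induction k)
    case 0
    then show ?case using cone.zero by (simp add: zero_fun_def)
  next
    case (Suc k)
    have "(\<lambda>a. \<Sum>i<Suc k. n i * (ps ! i) a)
        = (\<lambda>a. \<Sum>i<k. n i * (ps ! i) a) + (\<lambda>a. n k * (ps ! k) a)" by (simp add: fun_eq_iff)
    moreover have "\<dots> \<in> cone (set ps - {0})"
      using Suc by (intro cone_plus mult) (auto simp: zero_fun_def)
    ultimately show ?case by (simp only:)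
  qed
qed

text \<open>Division of every coefficient by \<open>m\<close>: the remainders \<open>r\<close> range
  over a finite set that a leader can guess, and the quotients give the vector \<open>y\<close> left
  to the fills.\<close>

lemma lin_divmod:
  assumes "0 < m"
  obtains r y where "r \<in> PiE {..<length ps} (\<lambda>_. {..<m})" "y \<in> cone (set ps - {0})"
    "lin c ps n = lin c ps r + (\<lambda>a. m * y a)"
proof
  let ?r = "restrict (\<lambda>i. n i mod m) {..<length ps}"
  let ?y = "\<lambda>a. \<Sum>i<length ps. (n i div m) * (ps ! i) a"
  show "?r \<in> PiE {..<length ps} (\<lambda>_. {..<m})" using assms by auto
  show "?y \<in> cone (set ps - {0})" by (rule lin_in_cone) simp
  have "(\<Sum>i<length ps. n i * (ps ! i) a) =
      (\<Sum>i<length ps. ?r i * (ps ! i) a) + m * ?y a" for a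
  proof -
    have "(\<Sum>i<length ps. n i * (ps ! i) a)
        = (\<Sum>i<length ps. (n i mod m + m * (n i div m)) * (ps ! i) a)" by simp
    also have "\<dots> = (\<Sum>i<length ps. ?r i * (ps ! i) a + m * ((n i div m) * (ps ! i) a))"
      by (intro sum.cong refl) (simp only: restrict_apply' add_mult_distrib mult.assoc)
    finally show ?thesis by (simp only: sum.distrib sum_distrib_left)
  qed
  then show "lin c ps n = lin c ps ?r + (\<lambda>a. m * ?y a)" by (simp add: fun_eq_iff)
qed

text \<open>Turns a word that places exactly \<open>y\<close> on a label into a leader that leaves
  exactly \<open>y\<close> dotted there.\<close>

definition swap :: "nat + nat \<Rightarrow> nat + nat" where
  "swap = case_sum Inr Inl"

lemma swap_simps [simp]: "swap (Inl a) = Inr a" "swap (Inr a) = Inl a"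
  by (simp_all add: swap_def)

lemma sym_swap [simp]: "sym (swap l) = sym l"
  by (cases l) auto

lemma isl_swap [simp]: "isl (swap l) \<longleftrightarrow> \<not> isl l"
  by (cases l) auto

lemma cnt_swap: "cnt m Q e (map swap w) = cnt m (\<lambda>l. Q (swap l)) e w"
  by (induction w arbitrary: e) auto

lemma dotted_all: "dotted m t e (map Inr x) = occs m t e (map Inr x)"
  by (induction x arbitrary: e) auto

lemma map_sym_Inr: "map sym (map Inr x) = x" and map_sym_Inl: "map sym (map Inl x) = x"
  by (induction x) auto

text \<open>Each dotted occurrence with label \<open>b\<close> stands for \<open>m\<close>
  occurrences of its letter. If the fills confirm that the dotted vector lies in the cone, the
  Parikh vector lies in the linear set.\<close>

definition linear_lead ::
  "nat set \<Rightarrow> nat \<Rightarrow> nat \<Rightarrow> (nat \<Rightarrow> nat) \<Rightarrow> (nat \<Rightarrow> nat) list \<Rightarrow> (nat \<Rightarrow> nat) \<Rightarrow> (nat + nat) list set" where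
  "linear_lead \<Sigma> m b c ps e = {s \<in> lists (ext_alph \<Sigma>). dotted_off m b e s = 0 \<and>
     (\<exists>r\<in>PiE {..<length ps} (\<lambda>_. {..<m}).
        parikh (map sym s) = lin c ps r + (\<lambda>a. m * dotted m b e s a))}"

lemma regular_linear_lead:
  assumes "finite \<Sigma>" "b < m" "e \<in> offs \<Sigma> m" "e' \<in> offs \<Sigma> m"
  shows "regular {s \<in> linear_lead \<Sigma> m b c ps e. off m e s = e'}"
proof -
  let ?R = "PiE {..<length ps} (\<lambda>_. {..<m})"
  \<comment> \<open>Given the offsets at both ends, Parikh vector minus \<open>m\<close> times the dotted occurrences is
    determined by the number of placed occurrences with label \<open>b\<close>, which only grows.\<close>
  let ?D = "\<lambda>r. {d. \<forall>a. lin c ps r a + e a + m * of_bool (b < e' a)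
     = e' a + m * d a + m * of_bool (b < e a)}"
  have "{s \<in> linear_lead \<Sigma> m b c ps e. off m e s = e'} =
    (\<Union>r\<in>?R. \<Union>d\<in>?D r. {s \<in> lists (ext_alph \<Sigma>). off m e s = e' \<and>
       dotted_off m b e s = 0 \<and> placed m b e s = d})" (is "?A = ?B")
  proof -
    have "parikh (map sym s) = lin c ps r + (\<lambda>a. m * dotted m b e s a) \<longleftrightarrow> placed m b e s \<in> ?D r"
      if "s \<in> lists (ext_alph \<Sigma>)" "off m e s = e'" for s r
    proof -
      have "count_list (map sym s) a + e a + m * of_bool (b < e' a)
          = e' a + m * (placed m b e s a + dotted m b e s a) + m * of_bool (b < e a)" for a
        using count_occs[OF assms(3) that(1) assms(2), of a] that(2)
        by (simp add: occs_split)
      then have "count_list (map sym s) a = lin c ps r a + m * dotted m b e s a \<longleftrightarrow>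
          lin c ps r a + e a + m * of_bool (b < e' a)
          = e' a + m * placed m b e s a + m * of_bool (b < e a)" for a
        by (smt (verit) add.assoc add.commute add_left_cancel distrib_left)
      then show ?thesis by (auto simp: parikh_def fun_eq_iff)
    qed
    then show ?thesis unfolding linear_lead_def by blast
  qed
  moreover have "finite (?D r)" for r
  proof -
    \<comment> \<open>As \<open>m > 0\<close>, the equation fixes every coordinate of
      \<open>d\<close>, so \<open>?D r\<close> has at most one element.\<close>
    have "d = d'" if "d \<in> ?D r" "d' \<in> ?D r" for d d'
    proof
      fix a
      have "e' a + m * d a + m * of_bool (b < e a) = e' a + m * d' a + m * of_bool (b < e a)"
        using that by (metis (mono_tags, lifting) mem_Collect_eq)
      then show "d a = d' a" using assms(2) by simp
    qed
    then have unique: "?D r \<subseteq> {d}" if "d \<in> ?D r" for d using that by blast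
    show ?thesis
    proof (cases "?D r = {}")
      case True
      then show ?thesis by (simp only: finite.emptyI)
    next
      case False
      then obtain d where "d \<in> ?D r" by blast
      from unique[OF this] show ?thesis by (rule finite_subset) simp
    qed
  qed
  moreover have "finite ?R" by (intro finite_PiE) auto
  ultimately show ?thesis
    using regular_cnt[OF assms(1,3)] by (simp only: regular_UN)
qed

text \<open>A word with coefficients \<open>n\<close> has Parikh vector at least \<open>m\<close>
  times the quotient vector \<open>y\<close>, hence enough occurrences with label \<open>b\<close>
  to leave \<open>y\<close> dotted. Conversely, \<open>lin_plus_cone\<close> returns to the linear
  set.\<close>

lemma slotting_linear:
  assumes "finite \<Sigma>" "b < m"
  shows "slotting \<Sigma> m {b} {x \<in> lists \<Sigma>. \<exists>n. parikh x = lin c ps n}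
     (linear_lead \<Sigma> m b c ps) (\<lambda>t. if t = b then set ps - {0} else {})"
  unfolding slotting_def
proof (intro conjI ballI)
  let ?P = "\<lambda>t. if t = b then set ps - {0} else {}"
  let ?L = "{x \<in> lists \<Sigma>. \<exists>n. parikh x = lin c ps n}"
  show "\<forall>t. finite (?P t) \<and> 0 \<notin> ?P t" "\<forall>t. t \<notin> {b} \<longrightarrow> ?P t = {}" by auto
  fix e assume e: "e \<in> offs \<Sigma> m"
  show "linear_lead \<Sigma> m b c ps e \<subseteq> lists (ext_alph \<Sigma>)" by (auto simp: linear_lead_def)
  show "\<forall>t. t \<notin> {b} \<longrightarrow> dotted m t e s = 0" if "s \<in> linear_lead \<Sigma> m b c ps e" for s
    using that dotted_zeroI unfolding linear_lead_def by blast
  show "?L = {map sym s | s. s \<in> linear_lead \<Sigma> m b c ps e \<and> (\<forall>t. dotted m t e s \<in> cone (?P t))}"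
  proof (intro equalityI subsetI)
    fix x assume "x \<in> ?L"
    then obtain n where x: "x \<in> lists \<Sigma>" "parikh x = lin c ps n" by blast
    from assms(2) have "0 < m" by simp
    then obtain r y where r: "r \<in> PiE {..<length ps} (\<lambda>_. {..<m})" and y: "y \<in> cone (set ps - {0})"
      and ry: "lin c ps n = lin c ps r + (\<lambda>a. m * y a)"
      by (rule lin_divmod)
    \<comment> \<open>Dotting the whole word makes every occurrence with label \<open>b\<close>
      available for choosing \<open>y\<close>.\<close>
    let ?z = "map Inr x"
    have z: "?z \<in> lists (ext_alph \<Sigma>)" using x(1) by (simp only: map_sym_in_lists_iff map_sym_Inr)
    have "y \<le> dotted m b e ?z"
    proof (rule le_funI)
      fix a
      have "m * y a \<le> count_list (map sym ?z) a"
        using x(2) ry unfolding map_sym_Inr parikh_def fun_eq_iff by simp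
      from occs_ge[OF e z assms(2) this] show "y a \<le> dotted m b e ?z a"
        by (simp only: dotted_all)
    qed
    then obtain w z' where w: "wmatch ?z w = Some z'" "placed m b e w = y" "placed_off m b e w = 0"
      by (rule wmatch_choose)
    let ?s = "map swap w"
    have s: "map sym ?s = x" using wmatch_sym[OF w(1)] map_sym_Inr by (simp add: comp_def)
    have d: "dotted m b e ?s = y" "dotted_off m b e ?s = 0"
      using w(2,3) by (simp_all add: cnt_swap)
    have "?s \<in> lists (ext_alph \<Sigma>)" using x(1) s by (simp only: map_sym_in_lists_iff)
    moreover have "parikh (map sym ?s) = lin c ps r + (\<lambda>a. m * dotted m b e ?s a)"
      by (simp only: s d(1) x(2) ry)
    ultimately have "?s \<in> linear_lead \<Sigma> m b c ps e"
      unfolding linear_lead_def using d(2) r by blast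
    moreover have "dotted m t e ?s \<in> cone (?P t)" for t
      using d(1) y dotted_zeroI[OF d(2), of t] by (auto intro: cone.zero)
    ultimately show "x \<in> {map sym s | s. s \<in> linear_lead \<Sigma> m b c ps e \<and>
        (\<forall>t. dotted m t e s \<in> cone (?P t))}" using s by blast
  next
    fix x assume "x \<in> {map sym s | s. s \<in> linear_lead \<Sigma> m b c ps e \<and>
        (\<forall>t. dotted m t e s \<in> cone (?P t))}"
    then obtain s r where s: "x = map sym s" "s \<in> lists (ext_alph \<Sigma>)"
      "parikh x = lin c ps r + (\<lambda>a. m * dotted m b e s a)"
      and t: "\<forall>t. dotted m t e s \<in> cone (?P t)"
      unfolding linear_lead_def by blast
    have "dotted m b e s \<in> cone (set ps - {0})" using t[rule_format, of b] by simp
    from lin_plus_cone[OF this, of c r m] s show "x \<in> ?L"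
      by (simp add: map_sym_in_lists_iff)
  qed
  show "regular {s \<in> linear_lead \<Sigma> m b c ps e. off m e s = e'}" if "e' \<in> offs \<Sigma> m" for e'
    using regular_linear_lead[OF assms e that] .
qed

lemma slotted_linear:
  assumes "finite \<Sigma>"
  shows "slotted \<Sigma> {x \<in> lists \<Sigma>. \<exists>n. parikh x = lin c ps n}"
  unfolding slotted_def
proof (intro exI[of _ 1] allI impI)
  fix m b :: nat assume "b + 1 \<le> m"
  then have "b < m" by simp
  have "{b..<b + 1} = {b}" by auto
  then show "\<exists>Lead P. slotting \<Sigma> m {b..<b + 1} {x \<in> lists \<Sigma>. \<exists>n. parikh x = lin c ps n} Lead P"
    by (simp only:) (intro exI, rule slotting_linear[OF assms \<open>b < m\<close>])
qed

lemma slotted_commutative_semilinear: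
  assumes "finite \<Sigma>" "commutative \<Sigma> L" "semilinear_prop L"
  shows "slotted \<Sigma> L"
proof -
  obtain F where F: "finite F" "\<And>M. M \<in> F \<Longrightarrow> linear_prop M" "L = \<Union>F"
    using assms(3) unfolding semilinear_prop_def by blast
  \<comment> \<open>The sets \<open>M\<close> need not be commutative, so each is replaced by its
    commutative closure; commutativity of \<open>L\<close> makes the union of these closures equal
    to \<open>L\<close>.\<close>
  have *: "slotted \<Sigma> {x \<in> lists \<Sigma>. parikh x \<in> parikh ` M}" if M: "M \<in> F" for M
  proof -
    obtain c ps where "parikh ` M = {lin c ps n | n. True}"
      using F(2)[OF M] unfolding linear_prop_def by blast
    then have "{x \<in> lists \<Sigma>. parikh x \<in> parikh ` M} = {x \<in> lists \<Sigma>. \<exists>n. parikh x = lin c ps n}"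
      by blast
    then show ?thesis using slotted_linear[OF assms(1)] by simp
  qed
  have "slotted \<Sigma> {x \<in> lists \<Sigma>. parikh x \<in> parikh ` \<Union>G}" if "G \<subseteq> F" for G
    using finite_subset[OF that F(1)] that
  proof (induction G rule: finite_induct)
    case (insert M G)
    have "{x \<in> lists \<Sigma>. parikh x \<in> parikh ` \<Union>(insert M G)} =
      {x \<in> lists \<Sigma>. parikh x \<in> parikh ` M} \<union> {x \<in> lists \<Sigma>. parikh x \<in> parikh ` \<Union>G}" by auto
    then show ?case using insert * by (simp add: slotted_Un)
  qed (simp add: slotted_empty)
  from this[OF subset_refl] show ?thesis
    using assms(2) F(3) unfolding commutative_def by simp
qed

lemma slotted_Cfam: "L \<in> Cfam \<Sigma> \<Longrightarrow> finite \<Sigma> \<Longrightarrow> slotted \<Sigma> L"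
  by (induction rule: Cfam.induct)
    (blast intro: slotted_commutative_semilinear slotted_Un slotted_conc)+

section \<open>Leaders and fills as a base of a consensual language\<close>

section \<open>From leaders and fills to consensual languages\<close>

lemma langmatchI: "u \<in> A \<Longrightarrow> v \<in> B \<Longrightarrow> wmatch u v = Some z \<Longrightarrow> z \<in> langmatch A B"
  unfolding langmatch_def by blast

lemma langmatchE:
  assumes "z \<in> langmatch A B"
  obtains u v where "u \<in> A" "v \<in> B" "wmatch u v = Some z"
  using assms unfolding langmatch_def by blast

definition fills ::
  "nat set \<Rightarrow> nat \<Rightarrow> (nat \<Rightarrow> nat) \<Rightarrow> (nat \<Rightarrow> (nat \<Rightarrow> nat) set) \<Rightarrow> (nat + nat) list set" where
  "fills \<Sigma> m e P = {w \<in> lists (ext_alph \<Sigma>). \<exists>t. placed m t e w \<in> P t \<and> placed_off m t e w = 0}"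

lemma fills_placed:
  assumes "w \<in> fills \<Sigma> m e P"
  shows "placed m t e w \<in> cone (P t)"
proof -
  obtain t' where t': "placed m t' e w \<in> P t'" "placed_off m t' e w = 0"
    using assms unfolding fills_def by blast
  show ?thesis
  proof (cases "t = t'")
    case True
    then show ?thesis using cone.add[OF t'(1) cone.zero] by simp
  next
    case False
    then show ?thesis using placed_zeroI[OF t'(2)] by (simp add: cone.zero)
  qed
qed

text \<open>Keeps the empty word from being accepted without a leader.\<close>

lemma fills_nonempty: "(\<And>t. 0 \<notin> P t) \<Longrightarrow> w \<in> fills \<Sigma> m e P \<Longrightarrow> w \<noteq> []"
  unfolding fills_def by auto

lemma regular_fills:
  assumes "finite \<Sigma>" "e \<in> offs \<Sigma> m" "\<And>t. finite (P t)" "finite S" "\<And>t. t \<notin> S \<Longrightarrow> P t = {}"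
  shows "regular (fills \<Sigma> m e P)"
proof -
  have "fills \<Sigma> m e P = (\<Union>t\<in>S. \<Union>p\<in>P t. \<Union>e'\<in>offs \<Sigma> m. {w \<in> lists (ext_alph \<Sigma>).
      off m e w = e' \<and> placed m t e w = p \<and> placed_off m t e w = 0})"
    using off_in_offs[OF assms(2)] assms(5) unfolding fills_def by blast
  then show ?thesis
    using regular_cnt[OF assms(1,2)] assms(3,4) finite_offs[OF assms(1)]
    by (simp only: regular_UN)
qed

text \<open>At offset zero the first letter of a word carries label 0.\<close>

lemma occs_first:
  assumes "occs m 0 e w = 0" "\<And>a. e a = 0"
  shows "w = []"
proof (cases w)
  case (Cons l v)
  then have "occs m 0 e w (sym l) \<noteq> 0" using assms(2) by simp
  then show ?thesis using assms(1) by simp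
qed

lemma wmatch_count_dotted:
  "wmatch u v = Some z \<Longrightarrow>
    length (filter (\<lambda>l. \<not> isl l) u) = length (filter (\<lambda>l. \<not> isl l) z) + length (filter isl v)"
proof (induction u v arbitrary: z rule: wmatch.induct)
  case (2 x xs y ys)
  then show ?case
    by (cases x; cases y) (auto split: option.splits if_splits)
qed auto

lemma placed_nonzero: "placed m t e w \<noteq> 0 \<Longrightarrow> filter isl w \<noteq> []"
proof (induction w arbitrary: e)
  case (Cons l w)
  then show ?case by (cases "isl l") (auto simp: fun_eq_iff)
qed simp

lemma dotted_map_Inl: "dotted m t e (map Inl x) = 0"
  by (induction x arbitrary: e) (auto simp: fun_eq_iff)

lemma all_placed: "(\<And>t. dotted m t e z = 0) \<Longrightarrow> z = map Inl (map sym z)"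
proof (induction z arbitrary: e)
  case (Cons l z)
  have 0: "dotted m t e (l # z) a = 0" for t a
    unfolding Cons.prems by (rule zero_fun_apply)
  have "isl l" using 0[of "e (sym l)" "sym l"] by (auto split: if_splits)
  have "dotted m t (step m e (sym l)) z = 0" for t
    using 0[of t] by (auto simp: fun_eq_iff)
  from Cons.IH[OF this] \<open>isl l\<close> show ?case by (cases l) auto
qed simp

text \<open>Leaders alone place occurrences with label 0, and they place all of them: without a
  leader the first position stays dotted, and two leaders clash there.\<close>

lemma consensual_slotting:
  assumes slot: "slotting \<Sigma> m S L Lead P" and "finite \<Sigma>" "finite S" "0 \<notin> S" and e: "e \<in> offs \<Sigma> m"
    and e0: "\<And>a. e a = 0"
  shows "L \<in> CREG \<Sigma>"
proof -
  let ?B = "Lead e \<union> fills \<Sigma> m e P"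
  note sl = slottingD[OF slot]
  note sl4 = sl(4)[OF e] and sl6 = sl(6)[OF e] and sl7 = sl(7)[OF e]
  have lead0: "dotted m 0 e s = 0" if "s \<in> Lead e" for s
    using sl6[OF that] assms(4) by blast
  have P0: "P 0 = {}" using sl(3) assms(4) by blast
  have regular: "regular ?B"
  proof (rule regular_Un)
    have "Lead e = (\<Union>e'\<in>offs \<Sigma> m. {s \<in> Lead e. off m e s = e'})"
      by (auto intro: off_in_offs[OF e] dest: subsetD[OF sl4])
    moreover have "regular (\<Union>e'\<in>offs \<Sigma> m. {s \<in> Lead e. off m e s = e'})"
      using sl(5)[OF e] finite_offs[OF assms(2)] by (simp only: regular_UN)
    ultimately show "regular (Lead e)" by (simp only:)
    show "regular (fills \<Sigma> m e P)"
      using assms(2) e sl(1) assms(3) sl(3) by (rule regular_fills)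
  qed
  \<comment> \<open>\<open>?F\<close> describes a match of fills alone; \<open>?G\<close> one
    containing a leader \<open>s\<close>, where \<open>y\<close> is what the fills have placed so
    far.\<close>
  have invariant: "z \<noteq> [] \<and> (\<forall>t. placed m t e z \<in> cone (P t)) \<or>
      (\<exists>s\<in>Lead e. map sym s = map sym z \<and> (\<forall>t. \<exists>y\<in>cone (P t). dotted m t e s = dotted m t e z + y))"
    (is "?F z \<or> ?G z") if "z \<in> mpow ?B i" for z i
    using that
  proof (induction i arbitrary: z)
    case 0
    then consider "z \<in> Lead e" | "z \<in> fills \<Sigma> m e P" by auto
    then show ?case
    proof cases
      case 1
      then have "?G z" by (intro bexI[of _ z]) (auto intro: bexI[of _ 0] cone.zero)
      then show ?thesis ..
    next
      case 2
      then have "?F z" using fills_placed[OF 2] fills_nonempty[OF _ 2] sl(2) by blast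
      then show ?thesis ..
    qed
  next
    case (Suc i)
    from Suc.prems have "z \<in> langmatch (mpow ?B i) ?B" by (simp only: mpow.simps)
    then obtain u v where uv: "u \<in> mpow ?B i" "v \<in> ?B" "wmatch u v = Some z"
      by (rule langmatchE)
    note sym = wmatch_sym[OF uv(3)]
    consider (FF) "?F u" "v \<in> fills \<Sigma> m e P" | (FL) "?F u" "v \<in> Lead e"
      | (GF) "?G u" "v \<in> fills \<Sigma> m e P" | (GL) "?G u" "v \<in> Lead e"
      using Suc.IH[OF uv(1)] uv(2) by blast
    then show ?case
    proof cases
      case FF
      have "placed m t e z \<in> cone (P t)" for t
        unfolding wmatch_placed[OF uv(3)] using FF fills_placed by (blast intro: cone_plus)
      then show ?thesis using FF(1) sym by auto
    next
      case FL
      have "?G z" using FL sym wmatch_dotted(2)[OF uv(3)] by blast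
      then show ?thesis ..
    next
      case GF
      then obtain s where s: "s \<in> Lead e" "map sym s = map sym u"
        "\<And>t. \<exists>y\<in>cone (P t). dotted m t e s = dotted m t e u + y" by blast
      have "\<exists>y\<in>cone (P t). dotted m t e s = dotted m t e z + y" for t
      proof -
        obtain y where y: "y \<in> cone (P t)" "dotted m t e s = dotted m t e u + y" using s(3) by blast
        then have "dotted m t e s = dotted m t e z + (placed m t e v + y)"
          by (simp add: wmatch_dotted(1)[OF uv(3)] add.assoc)
        moreover have "placed m t e v + y \<in> cone (P t)"
          using fills_placed[OF GF(2)] y(1) by (rule cone_plus)
        ultimately show ?thesis by blast
      qed
      then have "?G z" using s(1,2) sym by metis
      then show ?thesis ..
    next
      case GL
      \<comment> \<open>Both words place every occurrence with label 0.\<close>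
      from GL(1) obtain s y where "s \<in> Lead e" "dotted m 0 e s = dotted m 0 e u + y" by blast
      then have "dotted m 0 e u = 0" using lead0[of s] by (auto simp: fun_eq_iff)
      moreover have "dotted m 0 e v = 0" using lead0[OF GL(2)] .
      ultimately have "dotted m 0 e z = 0" "placed m 0 e z = 0"
        using wmatch_dotted[OF uv(3), of m 0 e] wmatch_placed[OF uv(3), of m 0 e]
        by (auto simp: fun_eq_iff)
      then have "z = []" by (intro occs_first[of m e]) (simp_all add: occs_split e0)
      then have "z = v" using sym by simp
      then have "?G z" using GL(2) by (intro bexI[of _ v]) (auto intro: bexI[of _ 0] cone.zero)
      then show ?thesis ..
    qed
  qed
  have sound: "x \<in> L" if "map Inl x \<in> mpow ?B i" for x i
  proof -
    have d: "dotted m t e (map Inl x) = 0" for t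
      by (rule dotted_map_Inl)
    show ?thesis using invariant[OF that]
    proof
      assume F: "?F (map Inl x)"
      \<comment> \<open>Label 0 has no periods, so fills alone place nothing on it and cannot spell
        a nonempty word.\<close>
      then have "placed m 0 e (map Inl x) = 0" using P0 cone_empty by metis
      then have "map Inl x = ([] :: (nat + nat) list)"
        using d by (intro occs_first[of m e]) (simp_all add: occs_split e0)
      then show ?thesis using F by blast
    next
      assume "?G (map Inl x)"
      then obtain s where s: "s \<in> Lead e" "map sym s = x"
        "\<forall>t. \<exists>y\<in>cone (P t). dotted m t e s = dotted m t e (map Inl x) + y"
        unfolding map_sym_Inl by blast
      then have "\<forall>t. dotted m t e s \<in> cone (P t)" unfolding d by simp
      then show ?thesis using s sl7 by blast
    qed
  qed
  \<comment> \<open>Induction on the number of dotted positions: a nonzero cone vector yields a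
    period, and matching with a fill that places it lowers this number because periods are
    nonzero.\<close>
  have complete: "\<exists>i. map Inl x \<in> mpow ?B i"
    if "z \<in> mpow ?B i" "map sym z = x" "\<And>t. dotted m t e z \<in> cone (P t)" "x \<in> lists \<Sigma>" for x z i
    using that
  proof (induction "length (filter (\<lambda>l. \<not> isl l) z)" arbitrary: z i rule: less_induct)
    case less
    show ?case
    proof (cases "\<forall>t. dotted m t e z = 0")
      case True
      then have "z = map Inl x" using all_placed[of m e z] less.prems(2) by simp
      then show ?thesis using less.prems(1) by blast
    next
      case False
      then obtain t where "dotted m t e z \<noteq> 0" by blast
      then obtain p y where p: "p \<in> P t" "y \<in> cone (P t)" "dotted m t e z = p + y"
        using less.prems(3)[of t] by (auto elim: cone.cases)
      then have "p \<le> dotted m t e z" by (simp add: le_fun_def)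
      then obtain w z' where w: "wmatch z w = Some z'" "placed m t e w = p" "placed_off m t e w = 0"
        by (rule wmatch_choose)
      have sym: "map sym z' = x" "map sym w = x" using wmatch_sym[OF w(1)] less.prems(2) by auto
      then have "w \<in> lists (ext_alph \<Sigma>)" using less.prems(4) by (simp add: map_sym_in_lists_iff)
      then have "w \<in> ?B" unfolding fills_def using w(2,3) p(1) by blast
      then have z': "z' \<in> mpow ?B (Suc i)" using less.prems(1) w(1) by (auto intro: langmatchI)
      have "dotted m t' e z' \<in> cone (P t')" for t'
      proof (cases "t' = t")
        case True
        then have "dotted m t' e z' = y"
          using wmatch_dotted(1)[OF w(1), of m t e] p(3) w(2) by (auto simp: fun_eq_iff)
        then show ?thesis using p(2) True by simp
      next
        case False
        then show ?thesis
          using wmatch_dotted(1)[OF w(1), of m t' e] placed_zeroI[OF w(3) False] less.prems(3)[of t'] by simp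
      qed
      moreover have "length (filter (\<lambda>l. \<not> isl l) z') < length (filter (\<lambda>l. \<not> isl l) z)"
      proof -
        have "placed m t e w \<noteq> 0" using w(2) p(1) sl(2)[of t] by metis
        then have "filter isl w \<noteq> []" by (rule placed_nonzero)
        then show ?thesis using wmatch_count_dotted[OF w(1)] by simp
      qed
      ultimately show ?thesis using less.hyps[OF _ z' sym(1)] less.prems(4) by blast
    qed
  qed
  have "consensual ?B = L"
  proof (intro equalityI subsetI)
    fix x assume "x \<in> consensual ?B"
    then show "x \<in> L" using sound unfolding consensual_def mstar_def by blast
  next
    fix x assume "x \<in> L"
    then obtain s where s: "x = map sym s" "s \<in> Lead e" "\<And>t. dotted m t e s \<in> cone (P t)"
      using sl7 by blast
    have "s \<in> lists (ext_alph \<Sigma>)" using sl4 s(2) by blast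
    then have "x \<in> lists \<Sigma>" unfolding s(1) by (simp only: map_sym_in_lists_iff)
    moreover have "s \<in> mpow ?B 0" using s(2) by simp
    ultimately show "x \<in> consensual ?B"
      using complete[OF _ s(1)[symmetric] s(3)] unfolding consensual_def mstar_def by blast
  qed
  moreover have "?B \<subseteq> lists (ext_alph \<Sigma>)" using sl4 by (auto simp: fills_def)
  ultimately show ?thesis unfolding CREG_def using regular by blast
qed

lemma Cfam_subset_CREG:
  assumes "finite \<Sigma>"
  shows "Cfam \<Sigma> \<subseteq> CREG \<Sigma>"
proof
  fix L assume "L \<in> Cfam \<Sigma>"
  then have "slotted \<Sigma> L" using assms by (rule slotted_Cfam)
  \<comment> \<open>Starting the block at 1 keeps label 0 unowned; with the \<open>n\<close> owned
    labels this gives modulus \<open>1 + n\<close>.\<close>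
  then obtain n Lead P where "slotting \<Sigma> (1 + n) {1..<1 + n} L Lead P"
    unfolding slotted_def by (metis order_refl)
  then show "L \<in> CREG \<Sigma>"
    using assms by (rule consensual_slotting[of _ _ _ _ _ _ "\<lambda>_. 0"]) (auto simp: offs_def)
qed

section \<open>Strictness, witnessed by the words alternating between two letters\<close>

section \<open>A separating language\<close>

text \<open>In an alternating word over two letters the first and third letters agree, so exchanging
  the second and third keeps the Parikh vector but creates a repetition. This bounds the commutative
  languages; unions take the maximum of the bounds, concatenations the sum.\<close>

lemma Cfam_distinct_adj_bounded:
  assumes "A \<in> Cfam {0, 1}" "\<forall>w\<in>A. distinct_adj w"
  shows "\<exists>k. \<forall>w\<in>A. length w \<le> k"
  using assms
proof (induction rule: Cfam.induct)
  case (base L)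
  have False if w_in: "w \<in> L" and long: "length w > 2" for w
  proof -
    obtain x y z r where w: "w = x # y # z # r"
      using long by (auto simp: numeral_2_eq_2 less_eq_Suc_le Suc_le_length_iff)
    have "w \<in> lists {0, 1}" using w_in base.hyps(1) by blast
    moreover have "distinct_adj w" using w_in base.prems by blast
    ultimately have "x = z" "y \<noteq> z" unfolding w by auto
    have "parikh (x # z # y # r) = parikh w" unfolding w parikh_def by (auto simp: fun_eq_iff)
    moreover have "x # z # y # r \<in> lists {0, 1}" using \<open>w \<in> lists {0, 1}\<close> unfolding w by auto
    ultimately have "x # z # y # r \<in> L"
      using base.hyps(2) w_in unfolding commutative_def by (metis (mono_tags, lifting) image_eqI mem_Collect_eq)
    moreover have "\<not> distinct_adj (x # z # y # r)" using \<open>x = z\<close> by simp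
    ultimately show False using base.prems by blast
  qed
  then show ?case by (meson not_le_imp_less)
next
  case (union A B)
  then obtain k l where "\<forall>w\<in>A. length w \<le> k" "\<forall>w\<in>B. length w \<le> l" by blast
  then show ?case by (intro exI[of _ "max k l"]) (auto simp: le_max_iff_disj)
next
  case (concat A B)
  show ?case
  \<comment> \<open>The hypothesis passes to the words of one factor only when the other factor has
    a word to join them with.\<close>
  proof (cases "A = {} \<or> B = {}")
    case True
    then show ?thesis by (auto simp: conc_def)
  next
    case False
    have "distinct_adj (u @ v)" if "u \<in> A" "v \<in> B" for u v
      using that concat.prems unfolding conc_def by blast
    then have "\<forall>w\<in>A. distinct_adj w" "\<forall>w\<in>B. distinct_adj w"
      using False by (auto simp: distinct_adj_append_iff)
    then obtain k l where "\<forall>w\<in>A. length w \<le> k" "\<forall>w\<in>B. length w \<le> l"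
      using concat.IH by blast
    then show ?thesis by (intro exI[of _ "k + l"]) (auto simp: conc_def intro!: add_mono)
  qed
qed

definition alternating :: "(nat + nat) list set" where
  "alternating = rlang (Star (Times (Atom (Inl 0)) (Atom (Inl 1))))"

lemma lpow_alternating:
  "lpow (rlang (Times (Atom a) (Atom b))) n = {List.concat (replicate n [a, b])}"
  by (induction n) (auto simp: conc_def)

lemma alternating_eq:
  "alternating = {map Inl (List.concat (replicate n [0, 1])) | n. True}"
  unfolding alternating_def rlang.simps(6) lpow_alternating by (auto simp: map_concat)

text \<open>Two plain letters never match, so the only match between plain words is that of the
  empty word with itself.\<close>

lemma mpow_plain:
  assumes "B \<subseteq> range (map Inl)"
  shows "mpow B i \<subseteq> B"
proof (induction i)
  case (Suc i)
  have "z \<in> B" if uv: "u \<in> B" "v \<in> B" "wmatch u v = Some z" for u v z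
  proof -
    obtain x y where "u = map Inl x" "v = map Inl y" using assms uv by blast
    then show ?thesis using uv by (cases x; cases y) auto
  qed
  then show ?case using Suc by (auto elim!: langmatchE)
qed simp

lemma Cfam_ne_CREG: "Cfam {0, 1} \<noteq> CREG {0, 1}"
proof
  assume eq: "Cfam {0, 1} = CREG {0, 1}"
  let ?w = "\<lambda>n. List.concat (replicate n [0, 1 :: nat])"
  have "mstar alternating = alternating"
    using mpow_plain[of alternating] mpow.simps(1)[of alternating]
    unfolding mstar_def alternating_eq by blast
  then have C: "consensual alternating = {?w n | n. True}"
    unfolding consensual_def alternating_eq by (auto simp: inj_map_eq_map[OF inj_Inl])
  have "?w n \<in> lists {0, 1}" for n by (induction n) auto
  then have "map Inl (?w n) \<in> lists (ext_alph {0, 1})" for n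
    by (simp only: map_sym_in_lists_iff map_sym_Inl)
  then have "alternating \<subseteq> lists (ext_alph {0, 1})" unfolding alternating_eq by blast
  moreover have "regular alternating" unfolding regular_def alternating_def by blast
  ultimately have "{?w n | n. True} \<in> Cfam {0, 1}"
    unfolding eq CREG_def using C by blast
  moreover have "distinct_adj (?w n)" for n
  proof (induction n)
    case (Suc n)
    then show ?case by (cases n) auto
  qed simp
  ultimately have "\<exists>k. \<forall>w\<in>{?w n | n. True}. length w \<le> k"
    by (intro Cfam_distinct_adj_bounded) auto
  then obtain k where "\<forall>w\<in>{?w n | n. True}. length w \<le> k" ..
  then have "length (?w (Suc k)) \<le> k" by blast
  moreover have "length (?w n) = 2 * n" for n by (induction n) auto
  ultimately show False by simp
qed

theorem theorem4:
  shows "(\<forall>\<Sigma>::nat set. finite \<Sigma> \<longrightarrow> Cfam \<Sigma> \<subseteq> CREG \<Sigma>) \<and>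
         (\<exists>\<Sigma>::nat set. finite \<Sigma> \<and> Cfam \<Sigma> \<subset> CREG \<Sigma>)"
proof -
  have "finite {0, 1 :: nat}" by simp
  then have "finite {0, 1 :: nat} \<and> Cfam {0, 1} \<subset> CREG {0, 1}"
    using Cfam_subset_CREG Cfam_ne_CREG by blast
  then show ?thesis using Cfam_subset_CREG by blast
qed

end
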